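(* Let $c_e>0$, $c_i>0$, $\Delta t>0$, $\Delta x>0$, let $\beta=1-\frac{\sqrt2}{2}$, and let $\alpha\in[0,1]$ and $\theta=\alpha\,\frac{\beta}{1-\beta}=\alpha(\sqrt2-1)$ with $\theta\in(0,1)$. Assume that $$(1-\alpha)\,\frac{c_e\,\Delta t}{\Delta x}\le 1-\alpha,\qquad \alpha\,\frac{c_e\,\Delta t}{\Delta x}\le \alpha\,\frac{1}{\frac{\beta}{1-\beta}(2-\beta)}=\alpha\sqrt2 .$$ Then, for every $\varepsilon>0$, the limited scheme with parameter $\theta$ (defined in the context), with periodic boundary conditions, is $L^\infty$-stable and TVD, uniformly in $\varepsilon$ (the conditions $(1-\alpha)\,\frac{c_e\,\Delta t}{\Delta x}\le 1-\alpha$ and $\alpha\,\frac{c_e\,\Delta t}{\Delta x}\le \alpha\sqrt2$ do not involve $\varepsilon$): for all $n\ge 0$, $$\|w^\star\|_\infty\le\|w^n\|_\infty,\qquad \|w^{n+1}\|_\infty\le\|w^n\|_\infty,\qquad TV(w^\star)\le TV(w^n),\qquad TV(w^{n+1})\le TV(w^n).$$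
   Context: The scheme approximates the linear advection equation $\partial_t w+c_e\partial_x w+\frac{c_i}{\sqrt\varepsilon}\partial_x w=0$ with time step $\Delta t$ and space step $\Delta x$. Real unknowns $w^n_j$ (and intermediate values $w_j^\star$, which depend on $n$) are indexed by $j=1,\dots,L$, with periodic boundary conditions $w_0=w_L$, $w_{L+1}=w_1$ for $w=w^n$ and $w=w^\star$, for all $n\ge0$. Limited scheme with parameter $\theta$: for $j=1,\dots,L$ and $n\ge 0$, $$w_j^\star=w_j^n-\beta c_e\frac{\Delta t}{\Delta x}(w_j^n-w_{j-1}^n)-\beta\frac{c_i}{\sqrt\varepsilon}\frac{\Delta t}{\Delta x}(w_j^\star-w_{j-1}^\star),$$ $$\begin{aligned}w_j^{n+1}=w_j^n&-\theta(\beta-1)c_e\frac{\Delta t}{\Delta x}(w_j^n-w_{j-1}^n)-\theta(1-\beta)\frac{c_i}{\sqrt\varepsilon}\frac{\Delta t}{\Delta x}(w_j^\star-w_{j-1}^\star)\\&-\theta(2-\beta)c_e\frac{\Delta t}{\Delta x}(w_j^\star-w_{j-1}^\star)-\theta\beta\frac{c_i}{\sqrt\varepsilon}\frac{\Delta t}{\Delta x}(w_j^{n+1}-w_{j-1}^{n+1})\\&-(1-\theta)c_e\frac{\Delta t}{\Delta x}(w_j^n-w_{j-1}^n)-(1-\theta)\frac{c_i}{\sqrt\varepsilon}\frac{\Delta t}{\Delta x}(w_j^{n+1}-w_{j-1}^{n+1}).\end{aligned}$$ Notation: $\|w\|_\infty=\max_{1\le j\le L}|w_j|$ and $TV(w)=\sum_{j=1}^L|w_{j+1}-w_j|$.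 *)

theory Defs
  imports Complex_Main
begin

text \<open>
  A grid function is a map \<open>u :: nat \<Rightarrow> real\<close> of which only the values at \<open>0, \<dots>, L + 1\<close>
  matter; \<open>0\<close> and \<open>L + 1\<close> are the two ghost cells fixed by periodicity.
\<close>

definition periodic_bc :: "nat \<Rightarrow> (nat \<Rightarrow> real) \<Rightarrow> bool" where
  "periodic_bc L u \<longleftrightarrow> u 0 = u L \<and> u (L + 1) = u 1"

definition sup_norm :: "nat \<Rightarrow> (nat \<Rightarrow> real) \<Rightarrow> real" where
  "sup_norm L u = Max ((\<lambda>j. \<bar>u j\<bar>) ` {1..L})"

definition total_variation :: "nat \<Rightarrow> (nat \<Rightarrow> real) \<Rightarrow> real" where
  "total_variation L u = (\<Sum>j = 1..L. \<bar>u (j + 1) - u j\<bar>)"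

text \<open>
  \<open>w n\<close> is the approximation at time step \<open>n\<close>, and \<open>ws n\<close> is the intermediate value
  computed on the way from \<open>w n\<close> to \<open>w (n + 1)\<close>. Both stages are implicit,
  hence a relation rather than an update function.
\<close>

definition limited_scheme ::
    "real \<Rightarrow> real \<Rightarrow> real \<Rightarrow> real \<Rightarrow> real \<Rightarrow> real \<Rightarrow> real \<Rightarrow> nat \<Rightarrow>
      (nat \<Rightarrow> nat \<Rightarrow> real) \<Rightarrow> (nat \<Rightarrow> nat \<Rightarrow> real) \<Rightarrow> bool" where
  "limited_scheme \<beta> \<theta> c\<^sub>e c\<^sub>i \<epsilon> \<Delta>t \<Delta>x L w ws \<longleftrightarrow>
    (\<forall>n. periodic_bc L (w n) \<and> periodic_bc L (ws n)) \<and>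
    (\<forall>n. \<forall>j\<in>{1..L}.
      ws n j = w n j
        - \<beta> * c\<^sub>e * (\<Delta>t / \<Delta>x) * (w n j - w n (j - 1))
        - \<beta> * (c\<^sub>i / sqrt \<epsilon>) * (\<Delta>t / \<Delta>x) * (ws n j - ws n (j - 1))) \<and>
    (\<forall>n. \<forall>j\<in>{1..L}.
      w (n + 1) j = w n j
        - \<theta> * (\<beta> - 1) * c\<^sub>e * (\<Delta>t / \<Delta>x) * (w n j - w n (j - 1))
        - \<theta> * (1 - \<beta>) * (c\<^sub>i / sqrt \<epsilon>) * (\<Delta>t / \<Delta>x) * (ws n j - ws n (j - 1))
        - \<theta> * (2 - \<beta>) * c\<^sub>e * (\<Delta>t / \<Delta>x) * (ws n j - ws n (j - 1))
        - \<theta> * \<beta> * (c\<^sub>i / sqrt \<epsilon>) * (\<Delta>t / \<Delta>x) * (w (n + 1) j - w (n + 1) (j - 1))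
        - (1 - \<theta>) * c\<^sub>e * (\<Delta>t / \<Delta>x) * (w n j - w n (j - 1))
        - (1 - \<theta>) * (c\<^sub>i / sqrt \<epsilon>) * (\<Delta>t / \<Delta>x) * (w (n + 1) j - w (n + 1) (j - 1)))"

lemma beta_quotient_eq:
  fixes \<beta> :: real
  assumes "\<beta> = 1 - sqrt 2 / 2"
  shows "\<beta> / (1 - \<beta>) = sqrt 2 - 1"
proof -
  have "1 - \<beta> \<noteq> 0" and "\<beta> = (sqrt 2 - 1) * (1 - \<beta>)"
    unfolding assms by (simp_all add: algebra_simps)
  then show ?thesis by (metis nonzero_mult_div_cancel_right)
qed

lemma cfl_constant_eq:
  fixes \<beta> :: real
  assumes "\<beta> = 1 - sqrt 2 / 2"
  shows "1 / (\<beta> / (1 - \<beta>) * (2 - \<beta>)) = sqrt 2"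
proof -
  have "\<beta> / (1 - \<beta>) * (2 - \<beta>) = sqrt 2 / 2"
    unfolding beta_quotient_eq[OF assms] unfolding assms by (simp add: field_simps)
  moreover have "1 / (sqrt 2 / 2) = sqrt (2 :: real)"
    by (simp add: real_div_sqrt)
  ultimately show ?thesis by (rule subst[OF sym])
qed

end

theory Submission
  imports Defs
begin

text \<open>
  Write \<open>\<nu> = c\<^sub>e \<Delta>t / \<Delta>x\<close>, \<open>\<mu> = (c\<^sub>i / sqrt \<epsilon>) \<Delta>t / \<Delta>x\<close> and \<open>D u j = u j - u (j - 1)\<close>.
  The danger for stability uniform in \<open>\<epsilon>\<close> is the term \<open>- \<theta> (1 - \<beta>) \<mu> D ws\<close> of the second stage,
  which treats the stiff flux explicitly with a factor that is unbounded as \<open>\<epsilon>\<close> tends to \<open>0\<close>. But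
  \<open>\<theta> (1 - \<beta>) = \<alpha> \<beta>\<close>, and the first stage expresses \<open>\<beta> \<mu> D ws\<close> as \<open>w - ws - \<beta> \<nu> D w\<close>, free of
  \<open>\<mu>\<close>. After this substitution \<open>D w\<close> carries the factor \<open>(2 \<alpha> \<beta> + \<theta> - 1) \<nu>\<close>, and for
  \<open>\<beta> = 1 - sqrt 2 / 2\<close> this is \<open>- (1 - \<alpha>) \<nu>\<close>. The second stage has become
  \<open>(1 + (1 - \<alpha> \<beta>) \<mu> D) w' = (1 - \<alpha>) (w - \<nu> D w) + (\<alpha> ws - \<theta> (2 - \<beta>) \<nu> D ws)\<close>, where \<open>w'\<close> is the
  new time level. The two time step conditions say exactly that the four coefficients on the right, at \<open>w j\<close>,
  \<open>w (j - 1)\<close>, \<open>ws j\<close>, \<open>ws (j - 1)\<close>, are nonnegative; they add up to \<open>1\<close>. The first stage has the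
  same shape: \<open>(1 + \<beta> \<mu> D) ws\<close> is a convex combination of two neighbouring values of \<open>w\<close>.

  So both stages are instances of one fact: if \<open>(1 + k D) v\<close>, with \<open>k \<ge> 0\<close>, is a convex combination
  of neighbouring values of \<open>u\<close> and \<open>z\<close>, then the sup norm and the total variation of \<open>v\<close> are
  bounded by the same convex combination of those of \<open>u\<close> and \<open>z\<close>. It holds because implicit upwind
  differencing only mixes \<open>v j\<close> with \<open>v (j - 1)\<close>, and on a periodic grid a shift changes neither of
  the two quantities: \<open>upwind_sup_norm_le\<close> and \<open>upwind_total_variation_le\<close>.
\<close>

lemma abs_le_sup_norm: "j \<in> {1..L} \<Longrightarrow> \<bar>u j\<bar> \<le> sup_norm L u"
  unfolding sup_norm_def by (intro Max_ge finite_imageI imageI) simp_all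

lemma sup_norm_attained:
  assumes "1 \<le> L"
  obtains j where "j \<in> {1..L}" "sup_norm L u = \<bar>u j\<bar>"
proof -
  have "sup_norm L u \<in> (\<lambda>j. \<bar>u j\<bar>) ` {1..L}"
    unfolding sup_norm_def using assms by (intro Max_in) auto
  then show thesis using that by auto
qed

lemma abs_pred_le_sup_norm:
  assumes "periodic_bc L u" "j \<in> {1..L}"
  shows "\<bar>u (j - 1)\<bar> \<le> sup_norm L u"
proof (cases "j = 1")
  case True
  then have "u (j - 1) = u L" using assms(1) by (simp add: periodic_bc_def)
  then show ?thesis using assms(2) abs_le_sup_norm[of L L u] by auto
next
  case False
  then show ?thesis using assms(2) by (intro abs_le_sup_norm) auto
qed

lemma total_variation_shift:
  assumes "periodic_bc L u"
  shows "total_variation L u = (\<Sum>j = 1..L. \<bar>u j - u (j - 1)\<bar>)"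
proof (cases L)
  case 0
  then show ?thesis by (simp add: total_variation_def)
next
  case (Suc M)
  let ?d = "\<lambda>j. \<bar>u (j + 1) - u j\<bar>"
  have wrap: "?d L = ?d 0"
    using assms by (simp add: periodic_bc_def)
  have "total_variation L u = (\<Sum>j = 1..M. ?d j) + ?d L"
    unfolding total_variation_def Suc by simp
  also have "\<dots> = (\<Sum>j = 0..M. ?d j)"
    unfolding wrap by (simp add: sum.atLeast_Suc_atMost)
  also have "\<dots> = (\<Sum>j = 1..L. \<bar>u j - u (j - 1)\<bar>)"
    unfolding Suc using sum.shift_bounds_cl_Suc_ivl[of "\<lambda>j. \<bar>u j - u (j - 1)\<bar>" 0 M] by simp
  finally show ?thesis .
qed

text \<open>
  At an index where \<open>\<bar>v\<bar>\<close> is largest, the neighbour weighted by \<open>k\<close> contributes at most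
  \<open>k * \<bar>v j\<bar>\<close>, which the left side absorbs, whatever the size of \<open>k\<close>.
\<close>

lemma upwind_sup_norm_le:
  assumes L: "1 \<le> L"
    and per: "periodic_bc L v" "periodic_bc L u" "periodic_bc L z"
    and nonneg: "0 \<le> k" "0 \<le> a" "0 \<le> b" "0 \<le> c" "0 \<le> d"
    and step: "\<And>j. j \<in> {1..L} \<Longrightarrow>
      (1 + k) * v j = k * v (j - 1) + a * u j + b * u (j - 1) + c * z j + d * z (j - 1)"
  shows "sup_norm L v \<le> (a + b) * sup_norm L u + (c + d) * sup_norm L z"
proof -
  obtain j where j: "j \<in> {1..L}" and sup: "sup_norm L v = \<bar>v j\<bar>"
    using sup_norm_attained[OF L] .
  have "(1 + k) * \<bar>v j\<bar> = \<bar>(1 + k) * v j\<bar>"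
    using nonneg(1) by (simp add: abs_mult)
  also have "\<dots> \<le> k * \<bar>v (j - 1)\<bar> + a * \<bar>u j\<bar> + b * \<bar>u (j - 1)\<bar> + c * \<bar>z j\<bar> + d * \<bar>z (j - 1)\<bar>"
    unfolding step[OF j]
    by (intro order_trans[OF abs_triangle_ineq] add_mono) (simp_all add: abs_mult nonneg)
  also have "\<dots> \<le> k * sup_norm L v + a * sup_norm L u + b * sup_norm L u
      + c * sup_norm L z + d * sup_norm L z"
    by (intro add_mono mult_left_mono nonneg abs_le_sup_norm abs_pred_le_sup_norm per j)
  finally show ?thesis unfolding sup by (simp add: algebra_simps)
qed

text \<open>
  The increments of \<open>v\<close> satisfy the same stencil as \<open>v\<close>. Summed over a period, the increments
  and the shifted increments give the same total variation, so the terms with \<open>k\<close> cancel.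
\<close>

lemma upwind_total_variation_le:
  assumes per: "periodic_bc L v" "periodic_bc L u" "periodic_bc L z"
    and nonneg: "0 \<le> k" "0 \<le> a" "0 \<le> b" "0 \<le> c" "0 \<le> d"
    and step: "\<And>j. j \<in> {1..L} \<Longrightarrow>
      (1 + k) * v j = k * v (j - 1) + a * u j + b * u (j - 1) + c * z j + d * z (j - 1)"
  shows "total_variation L v \<le> (a + b) * total_variation L u + (c + d) * total_variation L z"
proof -
  \<comment> \<open>The increment from \<open>L\<close> to \<open>L + 1\<close> needs the stencil in the ghost cell as well.\<close>
  have next_step: "(1 + k) * v (j + 1) = k * v j + a * u (j + 1) + b * u j + c * z (j + 1) + d * z j"
    if j: "j \<in> {1..L}" for j
  proof (cases "j = L")
    case True
    then show ?thesis using step[of 1] per j by (simp add: periodic_bc_def)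
  next
    case False
    then show ?thesis using step[of "j + 1"] j by simp
  qed
  have "(1 + k) * \<bar>v (j + 1) - v j\<bar> \<le> k * \<bar>v j - v (j - 1)\<bar> + a * \<bar>u (j + 1) - u j\<bar>
      + b * \<bar>u j - u (j - 1)\<bar> + c * \<bar>z (j + 1) - z j\<bar> + d * \<bar>z j - z (j - 1)\<bar>"
    if j: "j \<in> {1..L}" for j
  proof -
    have "(1 + k) * \<bar>v (j + 1) - v j\<bar> = \<bar>(1 + k) * v (j + 1) - (1 + k) * v j\<bar>"
      using nonneg(1) by (simp add: abs_mult flip: right_diff_distrib)
    also have "\<dots> = \<bar>k * (v j - v (j - 1)) + a * (u (j + 1) - u j) + b * (u j - u (j - 1))
        + c * (z (j + 1) - z j) + d * (z j - z (j - 1))\<bar>"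
      unfolding step[OF j] next_step[OF j] by (simp add: algebra_simps)
    also have "\<dots> \<le> k * \<bar>v j - v (j - 1)\<bar> + a * \<bar>u (j + 1) - u j\<bar>
        + b * \<bar>u j - u (j - 1)\<bar> + c * \<bar>z (j + 1) - z j\<bar> + d * \<bar>z j - z (j - 1)\<bar>"
      by (intro order_trans[OF abs_triangle_ineq] add_mono) (simp_all add: abs_mult nonneg)
    finally show ?thesis .
  qed
  then have "(\<Sum>j = 1..L. (1 + k) * \<bar>v (j + 1) - v j\<bar>) \<le>
      (\<Sum>j = 1..L. k * \<bar>v j - v (j - 1)\<bar> + a * \<bar>u (j + 1) - u j\<bar>
        + b * \<bar>u j - u (j - 1)\<bar> + c * \<bar>z (j + 1) - z j\<bar> + d * \<bar>z j - z (j - 1)\<bar>)"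
    by (rule sum_mono)
  also have "\<dots> = k * total_variation L v + a * total_variation L u + b * total_variation L u
      + c * total_variation L z + d * total_variation L z"
    unfolding sum.distrib sum_distrib_left[symmetric] total_variation_shift[OF per(1), symmetric]
      total_variation_shift[OF per(2), symmetric] total_variation_shift[OF per(3), symmetric]
    by (simp add: total_variation_def)
  finally show ?thesis
    unfolding sum_distrib_left[symmetric] total_variation_def[of L v, symmetric]
    by (simp add: algebra_simps)
qed

text \<open>
  Eliminating the stiff term \<open>\<mu> * (zj - zp)\<close> between the two stages. The suffixes \<open>j\<close> and \<open>p\<close> stand
  for the values at a grid point and at its left neighbour; \<open>u\<close>, \<open>z\<close>, \<open>v\<close> for the old, intermediate
  and new values. The hypothesis \<open>\<theta> = \<alpha> * (1 - 2 * \<beta>)\<close> is what turns the coefficients of \<open>uj\<close> and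
  \<open>up\<close> into multiples of \<open>1 - \<alpha>\<close>.
\<close>

lemma second_stage_stencil:
  fixes \<beta> \<alpha> \<theta> \<nu> \<mu> uj up zj zp vj vp :: real
  assumes \<theta>1: "\<theta> * (1 - \<beta>) = \<alpha> * \<beta>" and \<theta>2: "\<theta> = \<alpha> * (1 - 2 * \<beta>)"
    and stage1: "zj = uj - \<beta> * \<nu> * (uj - up) - \<beta> * \<mu> * (zj - zp)"
    and stage2: "vj = uj - \<theta> * (\<beta> - 1) * \<nu> * (uj - up) - \<theta> * (1 - \<beta>) * \<mu> * (zj - zp)
      - \<theta> * (2 - \<beta>) * \<nu> * (zj - zp) - \<theta> * \<beta> * \<mu> * (vj - vp)
      - (1 - \<theta>) * \<nu> * (uj - up) - (1 - \<theta>) * \<mu> * (vj - vp)"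
  shows "(1 + (1 - \<alpha> * \<beta>) * \<mu>) * vj = (1 - \<alpha> * \<beta>) * \<mu> * vp
    + (1 - \<alpha>) * (1 - \<nu>) * uj + (1 - \<alpha>) * \<nu> * up
    + (\<alpha> - \<theta> * (2 - \<beta>) * \<nu>) * zj + \<theta> * (2 - \<beta>) * \<nu> * zp"
proof -
  have stiff: "\<theta> * (1 - \<beta>) * \<mu> * (zj - zp) = \<alpha> * (uj - zj - \<beta> * \<nu> * (uj - up))"
  proof -
    have "\<theta> * (1 - \<beta>) * \<mu> * (zj - zp) = \<alpha> * (\<beta> * \<mu> * (zj - zp))"
      unfolding \<theta>1 by simp
    also have "\<beta> * \<mu> * (zj - zp) = uj - zj - \<beta> * \<nu> * (uj - up)"
      using stage1 by linarith
    finally show ?thesis .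
  qed
  have anti: "\<theta> * (\<beta> - 1) = - (\<alpha> * \<beta>)"
    using \<theta>1 by (simp add: algebra_simps)
  have explicit: "\<theta> * (\<beta> - 1) * \<nu> * (uj - up) + (1 - \<theta>) * \<nu> * (uj - up)
      = (1 - \<theta> - \<alpha> * \<beta>) * \<nu> * (uj - up)"
    unfolding anti by (simp add: algebra_simps)
  have "\<theta> * \<beta> + (1 - \<theta>) = 1 - \<alpha> * \<beta>"
    using \<theta>1 by (simp add: algebra_simps)
  then have implicit: "\<theta> * \<beta> * \<mu> * (vj - vp) + (1 - \<theta>) * \<mu> * (vj - vp)
      = (1 - \<alpha> * \<beta>) * \<mu> * (vj - vp)"
    by (simp flip: distrib_right)
  have "vj + (1 - \<alpha> * \<beta>) * \<mu> * (vj - vp)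
      = (1 - \<alpha>) * uj + \<alpha> * zj - (1 - \<theta> - 2 * (\<alpha> * \<beta>)) * \<nu> * (uj - up)
        - \<theta> * (2 - \<beta>) * \<nu> * (zj - zp)"
    using stage2 stiff explicit implicit by (simp add: algebra_simps)
  moreover have "1 - \<theta> - 2 * (\<alpha> * \<beta>) = 1 - \<alpha>"
    unfolding \<theta>2 by (simp add: algebra_simps)
  ultimately have "vj + (1 - \<alpha> * \<beta>) * \<mu> * (vj - vp)
      = (1 - \<alpha>) * uj + \<alpha> * zj - (1 - \<alpha>) * \<nu> * (uj - up) - \<theta> * (2 - \<beta>) * \<nu> * (zj - zp)"
    by metis
  then show ?thesis by (simp add: algebra_simps)
qed

theorem theorem3:
  fixes c\<^sub>e c\<^sub>i \<Delta>t \<Delta>x \<beta> \<alpha> \<theta> :: real and L :: nat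
  assumes "c\<^sub>e > 0" and "c\<^sub>i > 0" and "\<Delta>t > 0" and "\<Delta>x > 0"
    and "L \<ge> 1"
    and "\<beta> = 1 - sqrt 2 / 2"
    and "0 \<le> \<alpha>" and "\<alpha> \<le> 1"
    and "\<theta> = \<alpha> * (\<beta> / (1 - \<beta>))"
    and "0 < \<theta>" and "\<theta> < 1"
    and "(1 - \<alpha>) * (c\<^sub>e * \<Delta>t / \<Delta>x) \<le> 1 - \<alpha>"
    and "\<alpha> * (c\<^sub>e * \<Delta>t / \<Delta>x) \<le> \<alpha> * (1 / (\<beta> / (1 - \<beta>) * (2 - \<beta>)))"
  shows "\<forall>\<epsilon>>0. \<forall>w ws. limited_scheme \<beta> \<theta> c\<^sub>e c\<^sub>i \<epsilon> \<Delta>t \<Delta>x L w ws \<longrightarrow>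
    (\<forall>n. sup_norm L (ws n) \<le> sup_norm L (w n) \<and>
         sup_norm L (w (n + 1)) \<le> sup_norm L (w n) \<and>
         total_variation L (ws n) \<le> total_variation L (w n) \<and>
         total_variation L (w (n + 1)) \<le> total_variation L (w n))"
proof (intro allI impI)
  fix \<epsilon> :: real and w ws :: "nat \<Rightarrow> nat \<Rightarrow> real" and n :: nat
  assume "\<epsilon> > 0" and scheme: "limited_scheme \<beta> \<theta> c\<^sub>e c\<^sub>i \<epsilon> \<Delta>t \<Delta>x L w ws"
  define \<nu> \<mu> where "\<nu> = c\<^sub>e * \<Delta>t / \<Delta>x" and "\<mu> = c\<^sub>i / sqrt \<epsilon> * (\<Delta>t / \<Delta>x)"
  have \<nu>: "0 \<le> \<nu>" and \<mu>: "0 \<le> \<mu>"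
    using assms(1-4) \<open>\<epsilon> > 0\<close> by (simp_all add: \<nu>_def \<mu>_def)
  have ratio: "\<beta> / (1 - \<beta>) = 1 - 2 * \<beta>"
    using beta_quotient_eq[OF assms(6)] assms(6) by simp
  have root: "1 \<le> sqrt 2" "sqrt 2 < (2::real)"
    using real_sqrt_less_mono[of 2 4] by simp_all
  then have \<beta>: "0 < \<beta>" "\<beta> \<le> 1 / 2"
    using assms(6) by simp_all
  have \<theta>2: "\<theta> = \<alpha> * (1 - 2 * \<beta>)"
    using assms(9) ratio by simp
  have \<theta>1: "\<theta> * (1 - \<beta>) = \<alpha> * \<beta>"
    using assms(9) \<beta> by simp
  have "0 < \<alpha>"
    using assms(7,10) \<theta>2 by (cases "\<alpha> = 0") auto
  have cfl: "(1 - \<alpha>) * \<nu> \<le> 1 - \<alpha>"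
    using assms(12) by (simp add: \<nu>_def)
  have "\<alpha> * \<nu> \<le> \<alpha> * sqrt 2"
    using assms(13) unfolding cfl_constant_eq[OF assms(6)] \<nu>_def .
  then have \<nu>_root: "\<nu> \<le> sqrt 2"
    using \<open>0 < \<alpha>\<close> by simp
  \<comment> \<open>The first stage is a convex combination for Courant numbers up to \<open>1 / \<beta> \<ge> 2\<close>.\<close>
  have "\<beta> * \<nu> \<le> 1 / 2 * 2"
    using \<beta> \<nu> \<nu>_root root(2) by (intro mult_mono) auto
  then have \<beta>\<nu>: "\<beta> * \<nu> \<le> 1" by simp
  have cfl_ws: "\<theta> * (2 - \<beta>) * \<nu> \<le> \<alpha>"
  proof -
    have "\<beta> / (1 - \<beta>) * (2 - \<beta>) = 1 / sqrt 2"
      using cfl_constant_eq[OF assms(6)] by (metis inverse_eq_divide inverse_inverse_eq)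
    moreover have "\<theta> * (2 - \<beta>) * \<nu> = \<alpha> * (\<nu> * (\<beta> / (1 - \<beta>) * (2 - \<beta>)))"
      unfolding assms(9) by simp
    ultimately have "\<theta> * (2 - \<beta>) * \<nu> = \<alpha> * (\<nu> / sqrt 2)"
      by (metis mult.right_neutral times_divide_eq_right)
    also have "\<dots> \<le> \<alpha>"
      using \<nu>_root assms(7) by (intro mult_left_le) simp_all
    finally show ?thesis .
  qed
  have per: "periodic_bc L (w n)" "periodic_bc L (ws n)" "periodic_bc L (w (n + 1))"
    using scheme unfolding limited_scheme_def by blast+
  have stage1: "ws n j = w n j - \<beta> * \<nu> * (w n j - w n (j - 1)) - \<beta> * \<mu> * (ws n j - ws n (j - 1))"
    if "j \<in> {1..L}" for j
    using scheme that unfolding limited_scheme_def \<nu>_def \<mu>_def by (simp add: mult.assoc)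
  have stage2: "w (n + 1) j = w n j
      - \<theta> * (\<beta> - 1) * \<nu> * (w n j - w n (j - 1)) - \<theta> * (1 - \<beta>) * \<mu> * (ws n j - ws n (j - 1))
      - \<theta> * (2 - \<beta>) * \<nu> * (ws n j - ws n (j - 1))
      - \<theta> * \<beta> * \<mu> * (w (n + 1) j - w (n + 1) (j - 1))
      - (1 - \<theta>) * \<nu> * (w n j - w n (j - 1))
      - (1 - \<theta>) * \<mu> * (w (n + 1) j - w (n + 1) (j - 1))"
    if "j \<in> {1..L}" for j
    using scheme that unfolding limited_scheme_def \<nu>_def \<mu>_def by (simp add: mult.assoc)

  have nonneg1: "0 \<le> \<beta> * \<mu>" "0 \<le> 1 - \<beta> * \<nu>" "0 \<le> \<beta> * \<nu>"
    using \<beta> \<nu> \<mu> \<beta>\<nu> by simp_all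
  \<comment> \<open>The first stage has one explicit grid function only, so \<open>w n\<close> also fills the second slot, with
    weights \<open>0\<close>.\<close>
  have stencil1: "(1 + \<beta> * \<mu>) * ws n j = \<beta> * \<mu> * ws n (j - 1)
      + (1 - \<beta> * \<nu>) * w n j + \<beta> * \<nu> * w n (j - 1) + 0 * w n j + 0 * w n (j - 1)"
    if "j \<in> {1..L}" for j
    using stage1[OF that] by (simp add: algebra_simps)
  have sup1: "sup_norm L (ws n) \<le> sup_norm L (w n)"
    using upwind_sup_norm_le[OF assms(5) per(2,1,1) nonneg1 order_refl order_refl stencil1] by simp
  have tv1: "total_variation L (ws n) \<le> total_variation L (w n)"
    using upwind_total_variation_le[OF per(2,1,1) nonneg1 order_refl order_refl stencil1] by simp

  have "\<alpha> * \<beta> \<le> 1"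
    using assms(7,8) \<beta> by (intro mult_le_one) auto
  then have nonneg2: "0 \<le> (1 - \<alpha> * \<beta>) * \<mu>" "0 \<le> (1 - \<alpha>) * (1 - \<nu>)" "0 \<le> (1 - \<alpha>) * \<nu>"
    "0 \<le> \<alpha> - \<theta> * (2 - \<beta>) * \<nu>" "0 \<le> \<theta> * (2 - \<beta>) * \<nu>"
    using cfl cfl_ws assms(8,10) \<beta> \<nu> \<mu> by (simp_all add: right_diff_distrib)
  have stencil2: "(1 + (1 - \<alpha> * \<beta>) * \<mu>) * w (n + 1) j = (1 - \<alpha> * \<beta>) * \<mu> * w (n + 1) (j - 1)
      + (1 - \<alpha>) * (1 - \<nu>) * w n j + (1 - \<alpha>) * \<nu> * w n (j - 1)
      + (\<alpha> - \<theta> * (2 - \<beta>) * \<nu>) * ws n j + \<theta> * (2 - \<beta>) * \<nu> * ws n (j - 1)"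
    if "j \<in> {1..L}" for j
    by (rule second_stage_stencil[OF \<theta>1 \<theta>2 stage1[OF that] stage2[OF that]])
  have average: "(1 - \<alpha>) * x + \<alpha> * y \<le> x" if "y \<le> x" for x y
    using mult_left_mono[OF that assms(7)] by (simp add: algebra_simps)
  have weights: "(1 - \<alpha>) * (1 - \<nu>) + (1 - \<alpha>) * \<nu> = 1 - \<alpha>"
    "\<alpha> - \<theta> * (2 - \<beta>) * \<nu> + \<theta> * (2 - \<beta>) * \<nu> = \<alpha>"
    by (simp_all add: algebra_simps)
  have "sup_norm L (w (n + 1)) \<le> (1 - \<alpha>) * sup_norm L (w n) + \<alpha> * sup_norm L (ws n)"
    using upwind_sup_norm_le[OF assms(5) per(3,1,2) nonneg2 stencil2] unfolding weights .
  then have sup2: "sup_norm L (w (n + 1)) \<le> sup_norm L (w n)"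
    using average[OF sup1] by linarith
  have "total_variation L (w (n + 1))
      \<le> (1 - \<alpha>) * total_variation L (w n) + \<alpha> * total_variation L (ws n)"
    using upwind_total_variation_le[OF per(3,1,2) nonneg2 stencil2] unfolding weights .
  then have tv2: "total_variation L (w (n + 1)) \<le> total_variation L (w n)"
    using average[OF tv1] by linarith
  show "sup_norm L (ws n) \<le> sup_norm L (w n) \<and>
      sup_norm L (w (n + 1)) \<le> sup_norm L (w n) \<and>
      total_variation L (ws n) \<le> total_variation L (w n) \<and>
      total_variation L (w (n + 1)) \<le> total_variation L (w n)"
    using sup1 sup2 tv1 tv2 by blast
qed

end
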